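(* Let $N\ge 1$ and let $I_1,\ldots,I_N$ be positive integers. Let $\Omega$ be a subset of the index set $\{1,\ldots,I_1\}\times\cdots\times\{1,\ldots,I_N\}$, let $\mathcal{M}\in\mathbb{R}^{I_1\times\cdots\times I_N}$, and let $\mathcal{B}=\mathcal{P}_\Omega(\mathcal{M})$. Fix positive integers $r_1,\ldots,r_N$ and fixed weights $\alpha_1,\ldots,\alpha_N>0$ with $\sum_{n=1}^N\alpha_n=1$. Let $X_n^0\in\mathbb{R}^{I_n\times r_n}$, $Y_n^0\in\mathbb{R}^{r_n\times\prod_{j\ne n}I_j}$ ($n=1,\ldots,N$) and $\mathcal{Z}^0\in\mathbb{R}^{I_1\times\cdots\times I_N}$ be given with $\mathcal{P}_\Omega(\mathcal{Z}^0)=\mathcal{B}$, and let the sequence $\{(X^k,Y^k,\mathcal{Z}^k)\}_{k\ge 0}$, where $X^k=(X_1^k,\ldots,X_N^k)$ and $Y^k=(Y_1^k,\ldots,Y_N^k)$, be generated for $k=0,1,2,\ldots$ by $$X_n^{k+1}=Z_{(n)}^k(Y_n^k)^\top,\quad n=1,\ldots,N,$$ $$Y_n^{k+1}=\big((X_n^{k+1})^\top X_n^{k+1}\big)^\dagger(X_n^{k+1})^\top Z_{(n)}^k,\quad n=1,\ldots,N,$$ $$\mathcal{Z}^{k+1}=\mathcal{P}_{\Omega^c}\Big(\sum_{n=1}^N\alpha_n\,\mathrm{fold}_n(X_n^{k+1}Y_n^{k+1})\Big)+\mathcal{B}.$$ Let $\mathcal{W}^k=\mathcal{B}-\mathcal{P}_\Omega\big(\sum_{n=1}^N\alpha_n\,\mathrm{fold}_n(X_n^kY_n^k)\big)$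 and $\mathcal{T}^k=(X^k,Y^k,\mathcal{Z}^k,\mathcal{W}^k)$. Then any limit point $(X,Y,\mathcal{Z},\mathcal{W})$ of the sequence $\{\mathcal{T}^k\}$ (i.e. the limit of any convergent subsequence) satisfies the KKT conditions $$(X_nY_n-Z_{(n)})Y_n^\top=0,\quad n=1,\ldots,N,$$ $$X_n^\top(X_nY_n-Z_{(n)})=0,\quad n=1,\ldots,N,$$ $$\mathcal{Z}-\sum_{n=1}^N\alpha_n\,\mathrm{fold}_n(X_nY_n)-\mathcal{P}_\Omega(\mathcal{W})=0,$$ $$\mathcal{P}_\Omega(\mathcal{Z})-\mathcal{B}=0.$$
   Context: All matrices and tensors are real. For $\mathcal{Z}\in\mathbb{R}^{I_1\times\cdots\times I_N}$, the mode-$n$ unfolding $Z_{(n)}=\mathrm{unfold}_n(\mathcal{Z})\in\mathbb{R}^{I_n\times\prod_{j\ne n}I_j}$ is the matrix whose columns are the mode-$n$ fibers of $\mathcal{Z}$ (vectors obtained by fixing all indices except the $n$-th), in a fixed (lexicographical) order: entry $(i_1,\ldots,i_N)$ of $\mathcal{Z}$ goes to row $i_n$ and column $1+\sum_{k\ne n}(i_k-1)\prod_{m<k,\,m\ne n}I_m$. The map $\mathrm{fold}_n$ is the inverse of $\mathrm{unfold}_n$. $\mathcal{P}_\Omega$ is the linear map on tensors that keeps the entries with index in $\Omega$ and sets all other entries to zero; $\Omega^c$ is the complement of $\Omega$ and $\mathcal{P}_{\Omega^c}$ is defined analogously. $A^\dagger$ denotes the Moore–Penrose pseudo-inverse of $A$.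 The iteration is an alternating minimization scheme for the problem $\min_{X,Y,\mathcal{Z}}\sum_{n=1}^N\frac{\alpha_n}{2}\|X_nY_n-Z_{(n)}\|_F^2$ subject to $\mathcal{P}_\Omega(\mathcal{Z})=\mathcal{B}$, whose Lagrangian is $\sum_{n=1}^N\frac{\alpha_n}{2}\|X_nY_n-Z_{(n)}\|_F^2-\langle\mathcal{W},\mathcal{P}_\Omega(\mathcal{Z})-\mathcal{B}\rangle$. The scheme is run without rank adjustment and without stopping, producing an infinite sequence. *)

theory Defs
  imports
    "HOL-Library.FuncSet"
    "HOL-Library.Function_Algebras"
    "HOL-Analysis.Function_Topology"
    "Jordan_Normal_Form.Matrix"
begin

section \<open>Tensors\<close>

text \<open>
  Modes are numbered \<open>1, \<dots>, N\<close>. Rows and columns of the matrices in \<open>Jordan_Normal_Form\<close> are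
  numbered from \<open>0\<close>, and accordingly the entries of a multi-index \<open>i\<close> are numbered from \<open>0\<close> as
  well: \<open>i n\<close> ranges over \<open>{..<I n}\<close>.
\<close>

type_synonym tensor = "(nat \<Rightarrow> nat) \<Rightarrow> real"

definition idx :: "nat \<Rightarrow> (nat \<Rightarrow> nat) \<Rightarrow> (nat \<Rightarrow> nat) set" where
  "idx N I = (\<Pi>\<^sub>E n\<in>{1..N}. {..<I n})"

text \<open>
  A tensor is a function on multi-indices that is zero off the index set, so that equality,
  addition, subtraction and convergence of tensors are those of the function type.
\<close>

definition tensors :: "nat \<Rightarrow> (nat \<Rightarrow> nat) \<Rightarrow> tensor set" where
  "tensors N I = {Z. \<forall>i. i \<notin> idx N I \<longrightarrow> Z i = 0}"

definition proj :: "(nat \<Rightarrow> nat) set \<Rightarrow> tensor \<Rightarrow> tensor" where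
  "proj S Z = (\<lambda>i. if i \<in> S then Z i else 0)"

definition ncols :: "nat \<Rightarrow> (nat \<Rightarrow> nat) \<Rightarrow> nat \<Rightarrow> nat" where
  "ncols N I n = (\<Prod>j\<in>{1..N} - {n}. I j)"

definition unfold_col :: "nat \<Rightarrow> (nat \<Rightarrow> nat) \<Rightarrow> nat \<Rightarrow> (nat \<Rightarrow> nat) \<Rightarrow> nat" where
  "unfold_col N I n i = (\<Sum>k\<in>{1..N} - {n}. i k * (\<Prod>m\<in>{1..<k} - {n}. I m))"

definition unfold_mode :: "nat \<Rightarrow> (nat \<Rightarrow> nat) \<Rightarrow> nat \<Rightarrow> tensor \<Rightarrow> real mat" where
  "unfold_mode N I n Z = Matrix.mat (I n) (ncols N I n)
     (\<lambda>(p, q). Z (THE i. i \<in> idx N I \<and> i n = p \<and> unfold_col N I n i = q))"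

definition fold_mode :: "nat \<Rightarrow> (nat \<Rightarrow> nat) \<Rightarrow> nat \<Rightarrow> real mat \<Rightarrow> tensor" where
  "fold_mode N I n = the_inv_into (tensors N I) (unfold_mode N I n)"

definition weighted_fold ::
  "nat \<Rightarrow> (nat \<Rightarrow> nat) \<Rightarrow> (nat \<Rightarrow> real) \<Rightarrow> (nat \<Rightarrow> real mat) \<Rightarrow> (nat \<Rightarrow> real mat) \<Rightarrow> tensor" where
  "weighted_fold N I \<alpha> X Y = (\<lambda>i. \<Sum>n = 1..N. \<alpha> n * fold_mode N I n (X n * Y n) i)"

lemma digit_bij: "bij_betw (\<lambda>(x, y). y + x * P) ({..<m} \<times> {..<P}) {..<m * P :: nat}"
proof (rule bij_betw_byWitness[where f' = "\<lambda>z. (z div P, z mod P)"])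
  have "y + x * P < m * P" if "x < m" "y < P" for x y
  proof -
    have "y + x * P < (x + 1) * P" using that by simp
    also have "\<dots> \<le> m * P" using that by (intro mult_right_mono) auto
    finally show ?thesis .
  qed
  then show "(\<lambda>(x, y). y + x * P) ` ({..<m} \<times> {..<P}) \<subseteq> {..<m * P}" by auto
  have "z div P < m \<and> z mod P < P" if "z < m * P" for z
    using that by (cases "P = 0") (auto simp: less_mult_imp_div_less)
  then show "(\<lambda>z. (z div P, z mod P)) ` {..<m * P} \<subseteq> {..<m} \<times> {..<P}" by auto
qed auto

lemma radix_bij:
  fixes K n :: nat and I :: "nat \<Rightarrow> nat"
  shows "bij_betw (\<lambda>i. \<Sum>k\<in>{1..<K} - {n}. i k * (\<Prod>m\<in>{1..<k} - {n}. I m))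
     (\<Pi>\<^sub>E k\<in>{1..<K} - {n}. {..<I k}) {..<\<Prod>m\<in>{1..<K} - {n}. I m}"
proof (induction K)
  case 0
  then show ?case by (simp add: bij_betw_def lessThan_Suc)
next
  case (Suc K)
  show ?case
  proof (cases "K = 0 \<or> K = n")
    case True
    then have "{1..<Suc K} - {n} = {1..<K} - {n}" by auto
    then show ?thesis using Suc by simp
  next
    case False
    let ?J = "{1..<K} - {n}"
    let ?P = "\<Prod>m\<in>?J. I m"
    let ?f = "\<lambda>i. \<Sum>k\<in>?J. i k * (\<Prod>m\<in>{1..<k} - {n}. I m)"
    have J: "{1..<Suc K} - {n} = insert K ?J" "K \<notin> ?J" using False by auto
    have f: "?f (i(K := x)) = ?f i" for i x
      by (rule sum.cong) (use J in auto)
    have bij: "bij_betw (\<lambda>(x, i). (x, ?f i)) ({..<I K} \<times> (\<Pi>\<^sub>E k\<in>?J. {..<I k})) ({..<I K} \<times> {..<?P})"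
      using bij_betw_map_prod[OF bij_betw_id Suc] by (simp add: map_prod_def id_def)
    have dig: "bij_betw (\<lambda>(x, y). y + x * ?P) ({..<I K} \<times> {..<?P}) {..<I K * ?P}"
      by (rule digit_bij)
    have ins: "bij_betw (\<lambda>(x, i). i(K := x)) ({..<I K} \<times> (\<Pi>\<^sub>E k\<in>?J. {..<I k}))
        (\<Pi>\<^sub>E k\<in>insert K ?J. {..<I k})"
      unfolding bij_betw_def PiE_insert_eq using inj_combinator[OF J(2)] by auto
    let ?g = "\<lambda>i. i K * ?P + ?f i"
    have "?g \<circ> (\<lambda>(x, i). i(K := x)) = (\<lambda>(x, y). y + x * ?P) \<circ> (\<lambda>(x, i). (x, ?f i))"
      unfolding fun_eq_iff o_def split_paired_All case_prod_conv f fun_upd_same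
      by (intro allI add.commute)
    then have "bij_betw (?g \<circ> (\<lambda>(x, i). i(K := x))) ({..<I K} \<times> (\<Pi>\<^sub>E k\<in>?J. {..<I k})) {..<I K * ?P}"
      using bij_betw_trans[OF bij dig] by (simp only:)
    then have "bij_betw ?g (\<Pi>\<^sub>E k\<in>insert K ?J. {..<I k}) {..<I K * ?P}"
      using bij_betw_comp_iff[OF ins] by blast
    then show ?thesis
      unfolding J(1) using J(2) by simp
  qed
qed

lemma unfold_bij:
  assumes n: "n \<in> {1..N}"
  shows "bij_betw (\<lambda>i. (i n, unfold_col N I n i)) (idx N I) ({..<I n} \<times> {..<ncols N I n})"
proof -
  let ?J = "{1..N} - {n}"
  have J: "{1..N} = insert n ?J" "n \<notin> ?J" using n by auto
  have e: "{1..<Suc N} = {1..N}" by auto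
  have c: "bij_betw (unfold_col N I n) (\<Pi>\<^sub>E k\<in>?J. {..<I k}) {..<ncols N I n}"
    using radix_bij[where K = "Suc N" and n = n and I = I] unfolding e unfold_col_def[abs_def] ncols_def .
  have f: "unfold_col N I n (i(n := x)) = unfold_col N I n i" for i x
    unfolding unfold_col_def by (rule sum.cong) auto
  have "(\<Pi>\<^sub>E k\<in>{1..N}. {..<I k}) = (\<Pi>\<^sub>E k\<in>insert n ?J. {..<I k})"
    by (rule arg_cong[OF J(1), of "\<lambda>A. \<Pi>\<^sub>E k\<in>A. {..<I k}"])
  then have ins: "bij_betw (\<lambda>(x, i). i(n := x)) ({..<I n} \<times> (\<Pi>\<^sub>E k\<in>?J. {..<I k})) (idx N I)"
    unfolding bij_betw_def idx_def PiE_insert_eq using inj_combinator[OF J(2)] by auto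
  have "bij_betw (\<lambda>(x, i). (x, unfold_col N I n i)) ({..<I n} \<times> (\<Pi>\<^sub>E k\<in>?J. {..<I k}))
      ({..<I n} \<times> {..<ncols N I n})"
    using bij_betw_map_prod[OF bij_betw_id c] by (simp add: map_prod_def id_def)
  moreover have "(\<lambda>i. (i n, unfold_col N I n i)) \<circ> (\<lambda>(x, i). i(n := x)) = (\<lambda>(x, i). (x, unfold_col N I n i))"
    by (auto simp: f)
  ultimately have "bij_betw ((\<lambda>i. (i n, unfold_col N I n i)) \<circ> (\<lambda>(x, i). i(n := x)))
      ({..<I n} \<times> (\<Pi>\<^sub>E k\<in>?J. {..<I k})) ({..<I n} \<times> {..<ncols N I n})"
    by (simp only:)
  then show ?thesis using bij_betw_comp_iff[OF ins] by blast
qed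

lemma unfold_mode_entry:
  assumes n: "n \<in> {1..N}" and i: "i \<in> idx N I"
  shows "unfold_mode N I n Z $$ (i n, unfold_col N I n i) = Z i"
proof -
  have lt: "i n < I n" "unfold_col N I n i < ncols N I n"
    using bij_betwE[OF unfold_bij[OF n]] i by auto
  have "(THE j. j \<in> idx N I \<and> j n = i n \<and> unfold_col N I n j = unfold_col N I n i) = i"
    using bij_betw_imp_inj_on[OF unfold_bij[OF n]] i
    by (intro the_equality) (auto dest: inj_onD)
  with lt show ?thesis by (simp add: unfold_mode_def)
qed

lemma unfold_mode_bij:
  assumes n: "n \<in> {1..N}"
  shows "bij_betw (unfold_mode N I n) (tensors N I) (carrier_mat (I n) (ncols N I n))"
proof (rule bij_betw_byWitness[where f' = "\<lambda>A i. if i \<in> idx N I then A $$ (i n, unfold_col N I n i) else 0"])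
  show "\<forall>Z\<in>tensors N I. (\<lambda>i. if i \<in> idx N I
      then unfold_mode N I n Z $$ (i n, unfold_col N I n i) else 0) = Z"
    using unfold_mode_entry[OF n] by (auto simp: tensors_def)
  show "\<forall>A\<in>carrier_mat (I n) (ncols N I n). unfold_mode N I n
      (\<lambda>i. if i \<in> idx N I then A $$ (i n, unfold_col N I n i) else 0) = A"
  proof
    fix A :: "real mat" assume A: "A \<in> carrier_mat (I n) (ncols N I n)"
    let ?Z = "\<lambda>i. if i \<in> idx N I then A $$ (i n, unfold_col N I n i) else 0"
    show "unfold_mode N I n ?Z = A"
    proof (rule eq_matI)
      fix p q assume "p < dim_row A" "q < dim_col A"
      with A have "(p, q) \<in> {..<I n} \<times> {..<ncols N I n}" by auto
      then obtain i where "i \<in> idx N I" "(p, q) = (i n, unfold_col N I n i)"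
        using bij_betw_imp_surj_on[OF unfold_bij[OF n]] by blast
      then show "unfold_mode N I n ?Z $$ (p, q) = A $$ (p, q)"
        using unfold_mode_entry[OF n] by simp
    qed (use A in \<open>auto simp: unfold_mode_def\<close>)
  qed
qed (auto simp: unfold_mode_def tensors_def)

section \<open>Matrices\<close>

definition is_moore_penrose :: "real mat \<Rightarrow> real mat \<Rightarrow> bool" where
  "is_moore_penrose A P \<longleftrightarrow>
     P \<in> carrier_mat (dim_col A) (dim_row A) \<and>
     A * P * A = A \<and> P * A * P = P \<and> (A * P)\<^sup>T = A * P \<and> (P * A)\<^sup>T = P * A"

definition pinv :: "real mat \<Rightarrow> real mat" where
  "pinv A = (THE P. is_moore_penrose A P)"

text \<open>\<open>real mat\<close> carries no topology; convergence of matrices of a fixed size is entrywise.\<close>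

definition mat_lim :: "(nat \<Rightarrow> real mat) \<Rightarrow> real mat \<Rightarrow> bool" where
  "mat_lim A L \<longleftrightarrow>
     (\<forall>k. A k \<in> carrier_mat (dim_row L) (dim_col L)) \<and>
     (\<forall>p<dim_row L. \<forall>q<dim_col L. (\<lambda>k. A k $$ (p, q)) \<longlonglongrightarrow> L $$ (p, q))"

end

theory Submission
  imports Defs
begin

text \<open>
  The half step from \<open>(X\<^sup>k, Y\<^sup>k)\<close> to \<open>(X\<^sup>k\<^sup>+\<^sup>1, Y\<^sup>k\<^sup>+\<^sup>1)\<close> decreases each residual \<open>\<parallel>X\<^sub>n Y\<^sub>n - Z\<^sub>(\<^sub>n\<^sub>)\<parallel>\<^sup>2\<close> by at least
  \<open>\<parallel>D\<parallel>\<^sup>2\<close> for a matrix \<open>D\<close> with \<open>D Y\<^sub>n\<^sup>T = (X\<^sub>n Y\<^sub>n - Z\<^sub>(\<^sub>n\<^sub>)) Y\<^sub>n\<^sup>T\<close>, and since the weights sum to \<open>1\<close>, the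
  update of \<open>Z\<close> decreases the objective by half the square of the step length. The objective is
  nonnegative, so \<open>D\<^sup>k\<close> and \<open>Z\<^sup>k\<^sup>+\<^sup>1 - Z\<^sup>k\<close> tend to \<open>0\<close>. The former gives the first KKT condition along
  a convergent subsequence. The latter gives the second, because the normal equation
  \<open>X\<^sub>n\<^sup>T (X\<^sub>n Y\<^sub>n - Z\<^sub>(\<^sub>n\<^sub>)) = 0\<close> holds exactly with the new \<open>X\<^sub>n\<close>, \<open>Y\<^sub>n\<close> and the old \<open>Z\<close>. The other two
  conditions hold at every iterate with \<open>k \<ge> 1\<close> and pass to the limit.
\<close>

section \<open>Matrix algebra under dimension conditions\<close>

lemma mat_mult_assoc:
  fixes A B C :: "'a::semiring_0 mat"
  assumes "dim_col A = dim_row B" "dim_col B = dim_row C"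
  shows "(A * B) * C = A * (B * C)"
  by (rule assoc_mult_mat[of _ "dim_row A" "dim_row B" _ "dim_row C" _ "dim_col C"])
    (use assms in auto)

lemma mat_transpose_mult:
  fixes A B :: "'a::comm_semiring_0 mat"
  assumes "dim_col A = dim_row B"
  shows "(A * B)\<^sup>T = B\<^sup>T * A\<^sup>T"
  by (rule transpose_mult[of _ "dim_row A" "dim_row B" _ "dim_col B"]) (use assms in auto)

lemma mat_minus_mult:
  fixes A B C :: "'a::ring mat"
  assumes "dim_row A = dim_row B" "dim_col A = dim_row C" "dim_col B = dim_row C"
  shows "(A - B) * C = A * C - B * C"
  by (rule minus_mult_distrib_mat[of _ "dim_row B" "dim_row C" _ _ "dim_col C"])
    (use assms in auto)

lemma mat_mult_minus:
  fixes A B C :: "'a::ring mat"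
  assumes "dim_col A = dim_row B" "dim_row C = dim_row B" "dim_col B = dim_col C"
  shows "A * (B - C) = A * B - A * C"
  by (rule mult_minus_distrib_mat[of _ "dim_row A" "dim_row B" _ "dim_col C"])
    (use assms in auto)

lemma mat_add_mult:
  fixes A B C :: "'a::semiring_0 mat"
  assumes "dim_row A = dim_row B" "dim_col A = dim_row C" "dim_col B = dim_row C"
  shows "(A + B) * C = A * C + B * C"
  by (rule add_mult_distrib_mat[of _ "dim_row B" "dim_row C" _ _ "dim_col C"])
    (use assms in auto)

lemma mat_mult_add:
  fixes A B C :: "'a::semiring_0 mat"
  assumes "dim_col A = dim_row B" "dim_row C = dim_row B" "dim_col B = dim_col C"
  shows "A * (B + C) = A * B + A * C"
  by (rule mult_add_distrib_mat[of _ "dim_row A" "dim_row B" _ "dim_col C"])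
    (use assms in auto)

declare assoc_mult_mat [simp del]

text \<open>The premises are equations between dimensions, which the simplifier solves once the
  dimensions of the factors are given.\<close>

lemmas mat_ring =
  mat_mult_assoc mat_transpose_mult mat_minus_mult mat_mult_minus mat_add_mult mat_mult_add

lemma mat_mult_entry:
  assumes "p < dim_row A" "q < dim_col B" "dim_col A = dim_row B"
  shows "(A * B) $$ (p, q) = (\<Sum>k<dim_row B. A $$ (p, k) * B $$ (k, q))"
  using assms by (simp add: scalar_prod_def atLeast0LessThan)

section \<open>Frobenius inner product and norm\<close>

definition frob_inner :: "real mat \<Rightarrow> real mat \<Rightarrow> real" where
  "frob_inner A B = (\<Sum>p<dim_row A. \<Sum>q<dim_col A. A $$ (p, q) * B $$ (p, q))"

definition frob_sq :: "real mat \<Rightarrow> real" where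
  "frob_sq A = (\<Sum>p<dim_row A. \<Sum>q<dim_col A. (A $$ (p, q))\<^sup>2)"

lemma frob_sq_nonneg: "frob_sq A \<ge> 0"
  unfolding frob_sq_def by (intro sum_nonneg) auto

lemma frob_inner_self: "frob_inner A A = frob_sq A"
  unfolding frob_inner_def frob_sq_def by (simp add: power2_eq_square)

lemma entry_sq_le_frob_sq:
  assumes "p < dim_row A" "q < dim_col A"
  shows "(A $$ (p, q))\<^sup>2 \<le> frob_sq A"
proof -
  have "(A $$ (p, q))\<^sup>2 \<le> (\<Sum>q<dim_col A. (A $$ (p, q))\<^sup>2)"
    using assms by (intro member_le_sum) auto
  also have "\<dots> \<le> frob_sq A"
    unfolding frob_sq_def using assms
    by (intro member_le_sum[of _ _ "\<lambda>p. \<Sum>q<dim_col A. (A $$ (p, q))\<^sup>2"] sum_nonneg) auto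
  finally show ?thesis .
qed

lemma frob_sq_eq_0_imp:
  assumes "frob_sq A = 0"
  shows "A = 0\<^sub>m (dim_row A) (dim_col A)"
proof (rule eq_matI)
  fix p q assume "p < dim_row (0\<^sub>m (dim_row A) (dim_col A))" "q < dim_col (0\<^sub>m (dim_row A) (dim_col A))"
  then show "A $$ (p, q) = 0\<^sub>m (dim_row A) (dim_col A) $$ (p, q)"
    using entry_sq_le_frob_sq[of p A q] assms by simp
qed auto

lemma frob_inner_zero: "frob_inner (0\<^sub>m m n) A = 0"
  unfolding frob_inner_def by simp

lemma frob_sq_add:
  assumes "dim_row A = dim_row B" "dim_col A = dim_col B"
  shows "frob_sq (A + B) = frob_sq A + 2 * frob_inner A B + frob_sq B"
  using assms unfolding frob_sq_def frob_inner_def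
  by (simp add: power2_sum sum.distrib sum_distrib_left algebra_simps)

text \<open>Both sides are one triple sum; the swaps move the sum over the rows of \<open>X\<close>
  innermost. This adjointness later turns matrix equations into orthogonality.\<close>

lemma frob_inner_mult_left:
  assumes "dim_row A = dim_row X" "dim_col A = dim_col W" "dim_col X = dim_row W"
  shows "frob_inner A (X * W) = frob_inner (X\<^sup>T * A) W"
proof -
  have "frob_inner A (X * W) =
    (\<Sum>p<dim_row X. \<Sum>q<dim_col W. \<Sum>k<dim_row W. A $$ (p, q) * (X $$ (p, k) * W $$ (k, q)))"
    unfolding frob_inner_def using assms
    by (simp add: mat_mult_entry sum_distrib_left del: index_mult_mat(1))
  also have "\<dots> =
    (\<Sum>p<dim_row X. \<Sum>k<dim_row W. \<Sum>q<dim_col W. A $$ (p, q) * (X $$ (p, k) * W $$ (k, q)))"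
    by (intro sum.cong refl sum.swap)
  also have "\<dots> =
    (\<Sum>k<dim_row W. \<Sum>p<dim_row X. \<Sum>q<dim_col W. A $$ (p, q) * (X $$ (p, k) * W $$ (k, q)))"
    by (rule sum.swap)
  also have "\<dots> =
    (\<Sum>k<dim_row W. \<Sum>q<dim_col W. \<Sum>p<dim_row X. A $$ (p, q) * (X $$ (p, k) * W $$ (k, q)))"
    by (intro sum.cong refl sum.swap)
  also have "\<dots> = frob_inner (X\<^sup>T * A) W"
    unfolding frob_inner_def using assms
    by (simp add: mat_mult_entry sum_distrib_left sum_distrib_right mult_ac del: index_mult_mat(1))
  finally show ?thesis .
qed

lemma frob_inner_transpose:
  assumes "dim_row A = dim_row B" "dim_col A = dim_col B"
  shows "frob_inner A\<^sup>T B\<^sup>T = frob_inner A B"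
proof -
  have "frob_inner A\<^sup>T B\<^sup>T = (\<Sum>q<dim_col A. \<Sum>p<dim_row A. A $$ (p, q) * B $$ (p, q))"
    using assms unfolding frob_inner_def by simp
  also have "\<dots> = frob_inner A B"
    unfolding frob_inner_def by (rule sum.swap)
  finally show ?thesis .
qed

lemma frob_inner_mult_right:
  assumes "dim_row A = dim_row W" "dim_col A = dim_col Y" "dim_col W = dim_row Y"
  shows "frob_inner A (W * Y) = frob_inner (A * Y\<^sup>T) W"
proof -
  have "frob_inner A (W * Y) = frob_inner A\<^sup>T (Y\<^sup>T * W\<^sup>T)"
    using assms frob_inner_transpose[of A "W * Y"] by (simp add: mat_ring)
  also have "\<dots> = frob_inner (Y * A\<^sup>T) W\<^sup>T"
    using assms by (simp add: frob_inner_mult_left)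
  also have "\<dots> = frob_inner (A * Y\<^sup>T) W"
    using assms frob_inner_transpose[of "A * Y\<^sup>T" W] by (simp add: mat_ring)
  finally show ?thesis .
qed

section \<open>Generalized inverses and the pseudo-inverse\<close>

text \<open>
  Subtracting the rank-one matrix \<open>B E B\<close>, with \<open>E\<close> the inverse of a single nonzero entry of \<open>B\<close>,
  clears the column of that entry and keeps the zero columns.
\<close>

lemma ex_generalized_inverse:
  fixes B :: "'a::field mat"
  assumes "B \<in> carrier_mat m r"
  shows "\<exists>G\<in>carrier_mat r m. B * G * B = B"
  using assms
proof (induction "card {q. q < r \<and> (\<exists>p<m. B $$ (p, q) \<noteq> 0)}" arbitrary: B rule: less_induct)
  case (less B)
  have B: "dim_row B = m" "dim_col B = r" using less.prems by auto
  show ?case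
  proof (cases "\<exists>p<m. \<exists>q<r. B $$ (p, q) \<noteq> 0")
    case False
    then have "B = 0\<^sub>m m r" by (intro eq_matI) (use B in auto)
    then have "B * 0\<^sub>m r m * B = B" by simp
    then show ?thesis by (intro bexI[of _ "0\<^sub>m r m"]) auto
  next
    case True
    then obtain p q where pq: "p < m" "q < r" "B $$ (p, q) \<noteq> 0" by auto
    define E where "E = Matrix.mat r m (\<lambda>(i, j). if i = q \<and> j = p then inverse (B $$ (p, q)) else 0)"
    have E: "dim_row E = r" "dim_col E = m" by (auto simp: E_def)
    have EB: "(E * B) $$ (i, j) = (if i = q then inverse (B $$ (p, q)) * B $$ (p, j) else 0)"
      if "i < r" "j < r" for i j
    proof -
      have "(E * B) $$ (i, j) = (\<Sum>k<m. E $$ (i, k) * B $$ (k, j))"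
        using that B E by (simp add: mat_mult_entry del: index_mult_mat(1))
      also have "\<dots> = (\<Sum>k<m. if k = p then (if i = q then inverse (B $$ (p, q)) * B $$ (p, j) else 0) else 0)"
        using that by (intro sum.cong) (auto simp: E_def)
      finally show ?thesis using pq by simp
    qed
    define B' where "B' = B - B * (E * B)"
    have B'd: "dim_row B' = m" "dim_col B' = r" using B E by (auto simp: B'_def)
    have B': "B' $$ (i, j) = B $$ (i, j) - B $$ (i, q) * (inverse (B $$ (p, q)) * B $$ (p, j))"
      if "i < m" "j < r" for i j
    proof -
      have "(B * (E * B)) $$ (i, j) = (\<Sum>k<r. B $$ (i, k) * (E * B) $$ (k, j))"
        using that B E by (simp add: mat_mult_entry del: index_mult_mat(1))
      also have "\<dots> = (\<Sum>k<r. if k = q then B $$ (i, q) * (inverse (B $$ (p, q)) * B $$ (p, j)) else 0)"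
        using that by (intro sum.cong) (auto simp: EB simp del: index_mult_mat(1))
      finally have "(B * (E * B)) $$ (i, j) = B $$ (i, q) * (inverse (B $$ (p, q)) * B $$ (p, j))"
        using pq by simp
      then show ?thesis
        using that B E unfolding B'_def by (simp del: index_mult_mat(1))
    qed
    have "{q. q < r \<and> (\<exists>p<m. B' $$ (p, q) \<noteq> 0)} \<subset> {q. q < r \<and> (\<exists>p<m. B $$ (p, q) \<noteq> 0)}"
    proof
      show "{q. q < r \<and> (\<exists>p<m. B' $$ (p, q) \<noteq> 0)} \<subseteq> {q. q < r \<and> (\<exists>p<m. B $$ (p, q) \<noteq> 0)}"
      proof (clarify, rule ccontr)
        fix j i assume j: "j < r" "\<not> (\<exists>p<m. B $$ (p, j) \<noteq> 0)" and i: "i < m" "B' $$ (i, j) \<noteq> 0"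
        then have "B $$ (i, j) = 0" "B $$ (p, j) = 0" using pq by auto
        with B'[OF i(1) j(1)] i(2) show False by simp
      qed
      have "q \<notin> {q. q < r \<and> (\<exists>p<m. B' $$ (p, q) \<noteq> 0)}" using pq B' by auto
      then show "{q. q < r \<and> (\<exists>p<m. B' $$ (p, q) \<noteq> 0)} \<noteq> {q. q < r \<and> (\<exists>p<m. B $$ (p, q) \<noteq> 0)}"
        using pq by blast
    qed
    then have "card {q. q < r \<and> (\<exists>p<m. B' $$ (p, q) \<noteq> 0)} < card {q. q < r \<and> (\<exists>p<m. B $$ (p, q) \<noteq> 0)}"
      by (intro psubset_card_mono) auto
    from less.hyps[OF this] B'd obtain G where G: "G \<in> carrier_mat r m" "B' * G * B' = B'"
      by auto
    have Gd: "dim_row G = r" "dim_col G = m" using G by auto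
    \<comment> \<open>Both \<open>B * (1 - E * B)\<close> and \<open>(1 - B * E) * B\<close> equal
      \<open>B'\<close>, so the factors around \<open>G\<close> turn \<open>B * ?H * B\<close> into
      \<open>B * E * B + B' * G * B'\<close>, whose last term is \<open>B'\<close>.\<close>
    let ?H = "E + (1\<^sub>m r - E * B) * (G * (1\<^sub>m m - B * E))"
    have 1: "B * (1\<^sub>m r - E * B) = B'" "(1\<^sub>m m - B * E) * B = B'"
      using B E unfolding B'_def by (simp_all add: mat_ring)
    have "B * ?H * B = B * (E * B) + (B * (1\<^sub>m r - E * B)) * G * ((1\<^sub>m m - B * E) * B)"
      using B E Gd
      by (simp add: mat_mult_assoc mat_add_mult mat_mult_add)
    also have "\<dots> = B * (E * B) + B'" unfolding 1 G(2) ..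
    also have "\<dots> = B"
      by (rule eq_matI) (use B E in \<open>auto simp: B'_def\<close>)
    finally have "B * ?H * B = B" .
    moreover have "?H \<in> carrier_mat r m" using E B Gd by auto
    ultimately show ?thesis by blast
  qed
qed

text \<open>The last factor \<open>X\<close> cancels because
  \<open>D = ((X\<^sup>T * X) * K - 1) * X\<^sup>T\<close> satisfies \<open>D * X = 0\<close>: by
  adjointness, \<open>frob_sq D\<close> is then an inner product with zero.\<close>

lemma gram_inverse_cancel:
  fixes X :: "real mat"
  assumes X: "X \<in> carrier_mat m r" and K: "K \<in> carrier_mat r r"
    and inv: "(X\<^sup>T * X) * K * (X\<^sup>T * X) = X\<^sup>T * X"
  shows "(X\<^sup>T * X) * K * X\<^sup>T = X\<^sup>T"
proof -
  have d: "dim_row X = m" "dim_col X = r" "dim_row K = r" "dim_col K = r" using X K by auto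
  define E where "E = (X\<^sup>T * X) * K - 1\<^sub>m r"
  define D where "D = E * X\<^sup>T"
  have E: "dim_row E = r" "dim_col E = r" using d by (auto simp: E_def)
  have D: "dim_row D = r" "dim_col D = m" using d E by (auto simp: D_def)
  have "D * X = (X\<^sup>T * X) * K * (X\<^sup>T * X) - X\<^sup>T * X"
    unfolding D_def E_def using d by (simp add: mat_ring)
  then have DX: "D * X = 0\<^sub>m r r"
    unfolding inv using d by auto
  have "frob_sq D = frob_inner D (E * X\<^sup>T)"
    unfolding frob_inner_self[symmetric] D_def ..
  also have "\<dots> = frob_inner (D * X) E"
    using d D E by (simp add: frob_inner_mult_right)
  finally have "D = 0\<^sub>m r m"
    unfolding DX frob_inner_zero using frob_sq_eq_0_imp[of D] D by simp
  moreover have "(X\<^sup>T * X) * K * X\<^sup>T = D + X\<^sup>T"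
    unfolding D_def E_def using d by (auto simp: mat_ring intro!: eq_matI)
  ultimately show ?thesis using d by auto
qed

text \<open>Built from the orthogonal projection \<open>E\<close> onto the range of
  \<open>S\<close>. Row and column space of a symmetric matrix agree, so \<open>E\<close> serves as
  both \<open>S * P\<close> and \<open>P * S\<close>.\<close>

lemma ex_moore_penrose_symmetric:
  assumes S: "S \<in> carrier_mat r r" and sym: "S\<^sup>T = S"
  shows "\<exists>P. is_moore_penrose S P"
proof -
  have "S * S \<in> carrier_mat r r" using S by auto
  from ex_generalized_inverse[OF this] obtain H
    where H: "H \<in> carrier_mat r r" "(S * S) * H * (S * S) = S * S" by auto
  \<comment> \<open>As \<open>S * S\<close> is the Gram matrix of \<open>S\<close>, cancellation
    makes \<open>G\<close> a solution of the normal equations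
    \<open>S * (S * G) = S\<close>.\<close>
  define G where "G = H * S"
  have d: "dim_row S = r" "dim_col S = r" "dim_row H = r" "dim_col H = r" using S H by auto
  then have dG: "dim_row G = r" "dim_col G = r" by (auto simp: G_def)
  have SSG: "S * (S * G) = S"
    using gram_inverse_cancel[OF S H(1)] H(2) d unfolding sym G_def by (simp add: mat_ring)
  define E where "E = S * G"
  have dE: "dim_row E = r" "dim_col E = r" using d dG by (auto simp: E_def)
  have GSS: "G\<^sup>T * (S * S) = S"
    using arg_cong[OF SSG, of transpose_mat] d dG by (simp add: mat_ring sym)
  \<comment> \<open>Both sides equal \<open>G\<^sup>T * (S * S) * G\<close>.\<close>
  have ET: "E = G\<^sup>T * S"
    using arg_cong[OF GSS, of "\<lambda>A. A * G"] arg_cong[OF SSG, of "\<lambda>A. G\<^sup>T * A"] d dG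
    unfolding E_def by (simp add: mat_ring)
  have Esym: "E\<^sup>T = E"
    using d dG by (subst E_def) (simp add: mat_ring sym ET)
  have SE: "S * E = S" unfolding E_def by (rule SSG)
  have ES: "E * S = S"
    using arg_cong[OF SE, of transpose_mat] d dE by (simp add: mat_ring sym Esym)
  have EE: "E * E = E"
    using d dG dE SE by (subst ET) (simp add: mat_ring ET)
  \<comment> \<open>Compressing \<open>G\<close> by \<open>E\<close> on both sides adds
    \<open>E * P = P\<close>, which yields \<open>P * S * P = P\<close>.\<close>
  define P where "P = E * (G * E)"
  have dP: "dim_row P = r" "dim_col P = r" using dG dE by (auto simp: P_def)
  have "S * P = (S * E) * G * E"
    unfolding P_def using d dG dE by (simp add: mat_ring)
  then have SP: "S * P = E" unfolding SE E_def[symmetric] EE .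
  have "P * S = E * (G * (E * S))"
    unfolding P_def using d dG dE by (simp add: mat_ring)
  also have "\<dots> = G\<^sup>T * ((S * G) * S)"
    unfolding ES using d dG by (simp add: ET mat_ring)
  finally have PS: "P * S = E" by (simp add: ES flip: E_def ET)
  have "P * E = P" "E * P = P"
    unfolding P_def using dG dE EE mat_mult_assoc[of E E "G * E"]
    by (simp_all add: mat_mult_assoc)
  then have "is_moore_penrose S P"
    unfolding is_moore_penrose_def SP PS using d dP ES Esym by auto
  then show ?thesis ..
qed

text \<open>\<open>A * P\<close> and \<open>A * Q\<close> absorb each other, and by symmetry their
  product may be reversed, so they agree; likewise \<open>P * A\<close> and \<open>Q * A\<close>.
  Then \<open>P = P * A * P = Q * A * Q = Q\<close>.\<close>

lemma moore_penrose_unique: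
  assumes P: "is_moore_penrose A P" and Q: "is_moore_penrose A Q"
  shows "P = Q"
proof -
  have d: "dim_row P = dim_col A" "dim_col P = dim_row A" "dim_row Q = dim_col A" "dim_col Q = dim_row A"
    using P Q by (auto simp: is_moore_penrose_def)
  have p: "A * P * A = A" "P * A * P = P" "(A * P)\<^sup>T = A * P" "(P * A)\<^sup>T = P * A"
    and q: "A * Q * A = A" "Q * A * Q = Q" "(A * Q)\<^sup>T = A * Q" "(Q * A)\<^sup>T = Q * A"
    using P Q by (auto simp: is_moore_penrose_def)
  have "A * P = (A * Q) * (A * P)"
    using d q(1) by (simp flip: mat_mult_assoc)
  also have "\<dots> = ((A * P) * (A * Q))\<^sup>T"
    using d p q by (simp add: mat_transpose_mult[of "A * P" "A * Q"])
  also have "\<dots> = A * Q"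
    using d p(1) q(3) by (simp flip: mat_mult_assoc)
  finally have AP: "A * P = A * Q" .
  have "P * A = (P * A) * (Q * A)"
    using d q(1) by (simp add: mat_mult_assoc)
  also have "\<dots> = ((Q * A) * (P * A))\<^sup>T"
    using d p q by (simp add: mat_transpose_mult[of "Q * A" "P * A"])
  also have "\<dots> = Q * A"
    using d p(1) q(4) by (simp add: mat_mult_assoc)
  finally have PA: "P * A = Q * A" .
  have "P = P * (A * P)" using d p(2) by (simp add: mat_mult_assoc)
  also have "\<dots> = Q * A * Q" unfolding AP using d by (simp add: PA flip: mat_mult_assoc)
  finally show ?thesis unfolding q(2) .
qed

text \<open>Justifies the description in \<open>pinv\<close> for symmetric matrices, which covers
  the Gram matrices of the iteration.\<close>

lemma pinv_symmetric:
  assumes "S \<in> carrier_mat r r" "S\<^sup>T = S"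
  shows "is_moore_penrose S (pinv S)"
proof -
  obtain P where P: "is_moore_penrose S P" using ex_moore_penrose_symmetric[OF assms] ..
  show ?thesis unfolding pinv_def
    by (rule theI[of _ P]) (use P moore_penrose_unique in auto)
qed

lemma pinv_gram:
  assumes "X \<in> carrier_mat m r"
  shows "pinv (X\<^sup>T * X) \<in> carrier_mat r r"
    and "(X\<^sup>T * X) * pinv (X\<^sup>T * X) * X\<^sup>T = X\<^sup>T"
proof -
  have "X\<^sup>T * X \<in> carrier_mat r r" "(X\<^sup>T * X)\<^sup>T = X\<^sup>T * X"
    using assms by (auto simp: mat_transpose_mult)
  then have mp: "is_moore_penrose (X\<^sup>T * X) (pinv (X\<^sup>T * X))" by (rule pinv_symmetric)
  with assms show c: "pinv (X\<^sup>T * X) \<in> carrier_mat r r"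
    unfolding is_moore_penrose_def by auto
  show "(X\<^sup>T * X) * pinv (X\<^sup>T * X) * X\<^sup>T = X\<^sup>T"
    using mp by (intro gram_inverse_cancel[OF assms c]) (auto simp: is_moore_penrose_def)
qed

section \<open>Descent in one update of the factors\<close>

text \<open>
  The update \<open>X' = Z Y\<^sup>T\<close> omits the factor \<open>(Y Y\<^sup>T)\<^sup>\<dagger>\<close> of the least squares solution for fixed \<open>Y\<close>, but
  that solution is \<open>X' L\<close> for a generalized inverse \<open>L\<close> of \<open>Y Y\<^sup>T\<close>, and \<open>Y'\<close> is optimal for \<open>X'\<close>: so
  \<open>X' Y'\<close> is at least as good as \<open>X' L Y\<close>. The witness is \<open>D = (X - X' L) Y\<close>.
\<close>

lemma als_descent:
  fixes X Y Y' Z :: "real mat"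
  assumes "X \<in> carrier_mat m r" "Y \<in> carrier_mat r c" "Z \<in> carrier_mat m c" "Y' \<in> carrier_mat r c"
    and X': "X' = Z * Y\<^sup>T" and normal: "X'\<^sup>T * (X' * Y' - Z) = 0\<^sub>m r c"
  shows "\<exists>D\<in>carrier_mat m c. D * Y\<^sup>T = (X * Y - Z) * Y\<^sup>T \<and>
    frob_sq (X' * Y' - Z) + frob_sq D \<le> frob_sq (X * Y - Z)"
proof -
  have d: "dim_row X = m" "dim_col X = r" "dim_row Y = r" "dim_col Y = c" "dim_row Z = m"
    "dim_col Z = c" "dim_row Y' = r" "dim_col Y' = c" "dim_row X' = m" "dim_col X' = r"
    using assms by auto
  have "Y * Y\<^sup>T \<in> carrier_mat r r" using d by auto
  then obtain K where K: "K \<in> carrier_mat r r" "Y * Y\<^sup>T * K * (Y * Y\<^sup>T) = Y * Y\<^sup>T"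
    using ex_generalized_inverse by blast
  \<comment> \<open>Cancellation gives \<open>Y * Y\<^sup>T * K * Y = Y\<close>. Its transpose has
    the inverse on the side where it multiplies \<open>X'\<close>.\<close>
  define L where "L = K\<^sup>T"
  have dK: "dim_row K = r" "dim_col K = r" and dL: "dim_row L = r" "dim_col L = r"
    using K by (auto simp: L_def)
  have KY: "Y * Y\<^sup>T * K * Y = Y"
    using gram_inverse_cancel[of "Y\<^sup>T" c r K] K assms(2) by simp
  have "Y\<^sup>T * (L * (Y * Y\<^sup>T)) = (Y * Y\<^sup>T * K * Y)\<^sup>T"
    using d dK by (simp add: mat_ring L_def)
  then have L: "Y\<^sup>T * (L * (Y * Y\<^sup>T)) = Y\<^sup>T" unfolding KY .
  define D where "D = (X - X' * L) * Y"
  \<comment> \<open>\<open>R\<close> is the residual of the least squares factor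
    \<open>X' * L\<close> for fixed \<open>Y\<close>, with normal equation
    \<open>R * Y\<^sup>T = 0\<close>.\<close>
  define R where "R = X' * (L * Y) - Z"
  have dD: "dim_row D = m" "dim_col D = c" and dR: "dim_row R = m" "dim_col R = c"
    using d dL by (auto simp: D_def R_def)
  have RY: "R * Y\<^sup>T = 0\<^sub>m m r"
    unfolding R_def X' using d dL L by (simp add: mat_ring) auto
  have split: "X * Y - Z = R + D"
    unfolding D_def R_def using d dL by (auto simp: mat_ring intro!: eq_matI)
  \<comment> \<open>By adjointness \<open>R\<close> is orthogonal to \<open>D\<close>, so the old
    residual splits by Pythagoras.\<close>
  have "frob_inner R D = frob_inner (R * Y\<^sup>T) (X - X' * L)"
    unfolding D_def using d dL dR by (simp add: frob_inner_mult_right)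
  then have "frob_inner R D = 0" unfolding RY frob_inner_zero .
  then have 1: "frob_sq (X * Y - Z) = frob_sq R + frob_sq D"
    unfolding split using dD dR by (simp add: frob_sq_add)
  \<comment> \<open>Second use of Pythagoras: \<open>R\<close> differs from the new residual by a
    matrix with columns in the range of \<open>X'\<close>, to which the new residual is
    orthogonal.\<close>
  have "frob_inner (X' * Y' - Z) (X' * (L * Y - Y')) = frob_inner (X'\<^sup>T * (X' * Y' - Z)) (L * Y - Y')"
    using d dL by (simp add: frob_inner_mult_left)
  then have "frob_inner (X' * Y' - Z) (X' * (L * Y - Y')) = 0"
    unfolding normal frob_inner_zero .
  moreover have "R = (X' * Y' - Z) + X' * (L * Y - Y')"
    unfolding R_def using d dL by (auto simp: mat_ring intro!: eq_matI)
  ultimately have "frob_sq R = frob_sq (X' * Y' - Z) + frob_sq (X' * (L * Y - Y'))"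
    using d dL by (simp add: frob_sq_add)
  then have 2: "frob_sq (X' * Y' - Z) \<le> frob_sq R"
    using frob_sq_nonneg[of "X' * (L * Y - Y')"] by simp
  have "D * Y\<^sup>T = (X * Y - Z) * Y\<^sup>T"
    unfolding split using dD dR d by (simp add: mat_add_mult RY) auto
  with 1 2 dD show ?thesis by (intro bexI[of _ D]) auto
qed

text \<open>\<open>pinv_gram\<close> reduces \<open>X\<^sup>T * (X * Y)\<close> to
  \<open>X\<^sup>T * Z\<close>, even for a singular Gram matrix.\<close>

lemma pinv_normal_equation:
  assumes "X \<in> carrier_mat m r" "Z \<in> carrier_mat m c"
    and Y: "Y = pinv (X\<^sup>T * X) * X\<^sup>T * Z"
  shows "Y \<in> carrier_mat r c" and "X\<^sup>T * (X * Y - Z) = 0\<^sub>m r c"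
proof -
  have d: "dim_row X = m" "dim_col X = r" "dim_row Z = m" "dim_col Z = c"
    "dim_row (pinv (X\<^sup>T * X)) = r" "dim_col (pinv (X\<^sup>T * X)) = r"
    using assms(1,2) pinv_gram(1)[OF assms(1)] by auto
  show "Y \<in> carrier_mat r c" unfolding Y using d by auto
  have "X\<^sup>T * (X * Y) = ((X\<^sup>T * X) * pinv (X\<^sup>T * X) * X\<^sup>T) * Z"
    unfolding Y using d by (simp add: mat_mult_assoc)
  then show "X\<^sup>T * (X * Y - Z) = 0\<^sub>m r c"
    unfolding pinv_gram(2)[OF assms(1)] using d Y by (simp add: mat_mult_minus) auto
qed

section \<open>Folding, entrywise residuals and telescoping\<close>

lemma unfold_mode_carrier [simp]: "unfold_mode N I n Z \<in> carrier_mat (I n) (ncols N I n)"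
  unfolding unfold_mode_def by simp

lemma finite_idx [simp]: "finite (idx N I)"
  unfolding idx_def by (intro finite_PiE) auto

lemma fold_mode_apply:
  assumes n: "n \<in> {1..N}" and A: "A \<in> carrier_mat (I n) (ncols N I n)"
  shows "fold_mode N I n A i = (if i \<in> idx N I then A $$ (i n, unfold_col N I n i) else 0)"
proof -
  have "fold_mode N I n A \<in> tensors N I" "unfold_mode N I n (fold_mode N I n A) = A"
    unfolding fold_mode_def using unfold_mode_bij[OF n] A
    by (metis bij_betw_def the_inv_into_into order_refl, metis f_the_inv_into_f_bij_betw)
  then show ?thesis
    using unfold_mode_entry[OF n, of i I "fold_mode N I n A"] by (auto simp: tensors_def)
qed

text \<open>Unfolding only rearranges entries. The residuals of all modes thus become sums over one
  index set and can be combined entry by entry.\<close>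

lemma frob_sq_minus_unfold:
  assumes n: "n \<in> {1..N}" and A: "A \<in> carrier_mat (I n) (ncols N I n)"
  shows "frob_sq (A - unfold_mode N I n Z) = (\<Sum>i\<in>idx N I. (fold_mode N I n A i - Z i)\<^sup>2)"
proof -
  let ?U = "unfold_mode N I n Z"
  have U: "dim_row ?U = I n" "dim_col ?U = ncols N I n" unfolding unfold_mode_def by auto
  have "frob_sq (A - ?U) = (\<Sum>x\<in>{..<I n} \<times> {..<ncols N I n}. (A $$ x - ?U $$ x)\<^sup>2)"
    unfolding frob_sq_def by (simp add: sum.cartesian_product U case_prod_beta)
  also have "\<dots> = (\<Sum>i\<in>idx N I. (A $$ (i n, unfold_col N I n i) - ?U $$ (i n, unfold_col N I n i))\<^sup>2)"
    by (rule sum.reindex_bij_betw[OF unfold_bij[OF n], symmetric])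
  also have "\<dots> = (\<Sum>i\<in>idx N I. (fold_mode N I n A i - Z i)\<^sup>2)"
    by (intro sum.cong refl) (simp add: unfold_mode_entry[OF n] fold_mode_apply[OF n A])
  finally show ?thesis .
qed

text \<open>The terms with \<open>(F n)\<^sup>2\<close> cancel and the weights sum to one, so only
  the weighted mean of \<open>F\<close> remains. This links the update of \<open>Z\<close>, which
  uses that mean, to the objective.\<close>

lemma weighted_sq_diff:
  fixes \<alpha> F :: "'a \<Rightarrow> real"
  assumes "sum \<alpha> A = 1"
  shows "(\<Sum>n\<in>A. \<alpha> n * (F n - z)\<^sup>2) - (\<Sum>n\<in>A. \<alpha> n * (F n - w)\<^sup>2) =
    ((\<Sum>n\<in>A. \<alpha> n * F n) - z)\<^sup>2 - ((\<Sum>n\<in>A. \<alpha> n * F n) - w)\<^sup>2"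
proof -
  have "(\<Sum>n\<in>A. \<alpha> n * (F n - z)\<^sup>2) =
    (\<Sum>n\<in>A. \<alpha> n * (F n)\<^sup>2) - 2 * z * (\<Sum>n\<in>A. \<alpha> n * F n) + z\<^sup>2 * sum \<alpha> A" for z
    by (simp add: power2_diff algebra_simps sum.distrib sum_subtractf sum_distrib_left
        flip: sum_distrib_right)
  then show ?thesis using assms by (simp add: power2_diff algebra_simps)
qed

text \<open>Telescoping bounds the partial sums of \<open>g\<close> by \<open>f 0\<close>, so
  \<open>g\<close> is summable.\<close>

lemma descent_tendsto_zero:
  fixes f g :: "nat \<Rightarrow> real"
  assumes "\<And>k. f (Suc k) + g k \<le> f k" "\<And>k. f k \<ge> 0" "\<And>k. g k \<ge> 0"
  shows "g \<longlonglongrightarrow> 0"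
proof -
  have "f n + sum g {..<n} \<le> f 0" for n
    by (induction n) (use assms(1) in \<open>auto intro: order_trans[rotated] simp: add.commute add.left_commute\<close>)
  then have "sum g {..<n} \<le> f 0" for n
    using assms(2)[of n] by (smt (verit))
  then have "summable g"
    using assms(3) by (intro summableI_nonneg_bounded)
  then show ?thesis by (rule summable_LIMSEQ_zero)
qed

section \<open>Entrywise limits of matrices\<close>

lemma mat_lim_carrier: "mat_lim A L \<Longrightarrow> A k \<in> carrier_mat m n \<Longrightarrow> L \<in> carrier_mat m n"
  unfolding mat_lim_def by (metis carrier_matD carrier_mat_triv)

lemma mat_lim_unique:
  assumes "mat_lim A L" "mat_lim A L'"
  shows "L = L'"
proof (rule eq_matI)
  have d: "dim_row L = dim_row L'" "dim_col L = dim_col L'"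
    using mat_lim_carrier[OF assms(1), of 0] assms(2) unfolding mat_lim_def by auto
  then show "dim_row L = dim_row L'" "dim_col L = dim_col L'" by auto
  show "L $$ (p, q) = L' $$ (p, q)" if "p < dim_row L'" "q < dim_col L'" for p q
    using assms that d unfolding mat_lim_def by (metis LIMSEQ_unique)
qed

lemma mat_lim_mult:
  assumes "mat_lim A L" "mat_lim B L'" "dim_col L = dim_row L'"
  shows "mat_lim (\<lambda>k. A k * B k) (L * L')"
proof -
  have c: "A k \<in> carrier_mat (dim_row L) (dim_col L)" "B k \<in> carrier_mat (dim_row L') (dim_col L')" for k
    using assms unfolding mat_lim_def by auto
  have d: "dim_row (A k) = dim_row L" "dim_col (A k) = dim_col L"
    "dim_row (B k) = dim_row L'" "dim_col (B k) = dim_col L'" for k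
    using c[of k] by auto
  show ?thesis
    unfolding mat_lim_def
  proof (intro conjI allI impI)
    fix p q assume pq: "p < dim_row (L * L')" "q < dim_col (L * L')"
    have "(\<lambda>k. \<Sum>l<dim_row L'. A k $$ (p, l) * B k $$ (l, q)) \<longlonglongrightarrow>
        (\<Sum>l<dim_row L'. L $$ (p, l) * L' $$ (l, q))"
      using assms pq unfolding mat_lim_def by (intro tendsto_sum tendsto_mult) auto
    then show "(\<lambda>k. (A k * B k) $$ (p, q)) \<longlonglongrightarrow> (L * L') $$ (p, q)"
      using pq d assms(3) by (simp add: mat_mult_entry del: index_mult_mat(1))
  qed (use d in auto)
qed

lemma mat_lim_minus:
  assumes "mat_lim A L" "mat_lim B L'" "dim_row L = dim_row L'" "dim_col L = dim_col L'"
  shows "mat_lim (\<lambda>k. A k - B k) (L - L')"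
proof -
  have "B k \<in> carrier_mat (dim_row L') (dim_col L')" for k
    using assms unfolding mat_lim_def by auto
  then have "dim_row (B k) = dim_row L'" "dim_col (B k) = dim_col L'" for k by auto
  then show ?thesis
    using assms unfolding mat_lim_def by (auto intro!: tendsto_diff)
qed

lemma mat_lim_transpose:
  assumes "mat_lim A L"
  shows "mat_lim (\<lambda>k. (A k)\<^sup>T) L\<^sup>T"
proof -
  have "A k \<in> carrier_mat (dim_row L) (dim_col L)" for k
    using assms unfolding mat_lim_def by auto
  then have "dim_row (A k) = dim_row L" "dim_col (A k) = dim_col L" for k by auto
  then show ?thesis
    using assms unfolding mat_lim_def by auto
qed

lemma mat_lim_unfold_mode:
  assumes "\<And>i. (\<lambda>k. Z k i) \<longlonglongrightarrow> Zl i"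
  shows "mat_lim (\<lambda>k. unfold_mode N I n (Z k)) (unfold_mode N I n Zl)"
  using assms unfolding mat_lim_def by (auto simp: unfold_mode_def)

lemma mat_lim_frob_sq_zero:
  assumes "\<And>k. A k \<in> carrier_mat m n" "(\<lambda>k. frob_sq (A k)) \<longlonglongrightarrow> 0"
  shows "mat_lim A (0\<^sub>m m n)"
  unfolding mat_lim_def
proof (intro conjI allI impI)
  fix p q assume pq: "p < dim_row (0\<^sub>m m n)" "q < dim_col (0\<^sub>m m n)"
  have "(A k $$ (p, q))\<^sup>2 \<le> frob_sq (A k)" for k
    using entry_sq_le_frob_sq[of p "A k" q] assms(1)[of k] pq by auto
  then have "(\<lambda>k. (A k $$ (p, q))\<^sup>2) \<longlonglongrightarrow> 0"
    by (intro tendsto_sandwich[OF _ _ tendsto_const assms(2)] always_eventually) auto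
  then show "(\<lambda>k. A k $$ (p, q)) \<longlonglongrightarrow> 0\<^sub>m m n $$ (p, q)"
    using tendsto_real_sqrt[of _ 0] pq by (fastforce simp: tendsto_rabs_zero_iff)
qed (use assms(1) in auto)

lemma mat_lim_compose:
  assumes "mat_lim A L" "filterlim s at_top sequentially"
  shows "mat_lim (\<lambda>k. A (s k)) L"
  using assms filterlim_compose[OF _ assms(2)] unfolding mat_lim_def by blast

text \<open>Folding reads off matrix entries, and the entries of the products converge.\<close>

lemma weighted_fold_tendsto:
  assumes "\<And>n. n \<in> {1..N} \<Longrightarrow> mat_lim (\<lambda>k. X k n) (Xl n)"
    "\<And>n. n \<in> {1..N} \<Longrightarrow> mat_lim (\<lambda>k. Y k n) (Yl n)"
    "\<And>n. n \<in> {1..N} \<Longrightarrow> Xl n \<in> carrier_mat (I n) (r n)"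
    "\<And>n. n \<in> {1..N} \<Longrightarrow> Yl n \<in> carrier_mat (r n) (ncols N I n)"
  shows "(\<lambda>k. weighted_fold N I \<alpha> (X k) (Y k) i) \<longlonglongrightarrow> weighted_fold N I \<alpha> Xl Yl i"
  unfolding weighted_fold_def
proof (intro tendsto_sum tendsto_mult tendsto_const)
  fix n assume n: "n \<in> {1..N}"
  have L: "Xl n * Yl n \<in> carrier_mat (I n) (ncols N I n)"
    using assms(3,4)[OF n] by auto
  have lim: "mat_lim (\<lambda>k. X k n * Y k n) (Xl n * Yl n)"
    using assms[OF n] by (intro mat_lim_mult) auto
  then have c: "X k n * Y k n \<in> carrier_mat (I n) (ncols N I n)" for k
    using assms(3,4)[OF n] unfolding mat_lim_def by auto
  show "(\<lambda>k. fold_mode N I n (X k n * Y k n) i) \<longlonglongrightarrow> fold_mode N I n (Xl n * Yl n) i"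
  proof (cases "i \<in> idx N I")
    case True
    then have "i n < I n" "unfold_col N I n i < ncols N I n"
      using bij_betwE[OF unfold_bij[OF n]] by auto
    with True show ?thesis
      using lim assms(3,4)[OF n] unfolding fold_mode_apply[OF n L] fold_mode_apply[OF n c] mat_lim_def
      by (simp del: index_mult_mat(1))
  qed (simp add: fold_mode_apply[OF n L] fold_mode_apply[OF n c])
qed

lemma weighted_fold_off_idx:
  assumes "\<And>n. n \<in> {1..N} \<Longrightarrow> X n * Y n \<in> carrier_mat (I n) (ncols N I n)" "i \<notin> idx N I"
  shows "weighted_fold N I \<alpha> X Y i = 0"
  unfolding weighted_fold_def using assms by (intro sum.neutral) (simp add: fold_mode_apply)

section \<open>Limit points of the iteration are KKT points\<close>

theorem theorem4p1:
  fixes N :: nat and I r :: "nat \<Rightarrow> nat" and \<alpha> :: "nat \<Rightarrow> real"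
    and \<Omega> :: "(nat \<Rightarrow> nat) set" and M B :: tensor
    and X Y :: "nat \<Rightarrow> nat \<Rightarrow> real mat" and Z W :: "nat \<Rightarrow> tensor"
    and s :: "nat \<Rightarrow> nat"
    and Xl Yl :: "nat \<Rightarrow> real mat" and Zl Wl :: tensor
  assumes "N \<ge> 1"
    and "\<And>n. n \<in> {1..N} \<Longrightarrow> I n > 0"
    and "\<Omega> \<subseteq> idx N I"
    and "M \<in> tensors N I"
    and "B = proj \<Omega> M"
    and "\<And>n. n \<in> {1..N} \<Longrightarrow> r n > 0"
    and "\<And>n. n \<in> {1..N} \<Longrightarrow> \<alpha> n > 0"
    and "(\<Sum>n = 1..N. \<alpha> n) = 1"
    and "\<And>n. n \<in> {1..N} \<Longrightarrow> X 0 n \<in> carrier_mat (I n) (r n)"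
    and "\<And>n. n \<in> {1..N} \<Longrightarrow> Y 0 n \<in> carrier_mat (r n) (ncols N I n)"
    and "Z 0 \<in> tensors N I"
    and "proj \<Omega> (Z 0) = B"
    and "\<And>k n. n \<in> {1..N} \<Longrightarrow> X (Suc k) n = unfold_mode N I n (Z k) * (Y k n)\<^sup>T"
    and "\<And>k n. n \<in> {1..N} \<Longrightarrow>
      Y (Suc k) n = pinv ((X (Suc k) n)\<^sup>T * X (Suc k) n) * (X (Suc k) n)\<^sup>T * unfold_mode N I n (Z k)"
    and "\<And>k. Z (Suc k) = proj (idx N I - \<Omega>) (weighted_fold N I \<alpha> (X (Suc k)) (Y (Suc k))) + B"
    and "\<And>k. W k = B - proj \<Omega> (weighted_fold N I \<alpha> (X k) (Y k))"
    and "strict_mono s"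
    and "\<And>n. n \<in> {1..N} \<Longrightarrow> mat_lim (\<lambda>j. X (s j) n) (Xl n)"
    and "\<And>n. n \<in> {1..N} \<Longrightarrow> mat_lim (\<lambda>j. Y (s j) n) (Yl n)"
    and "(\<lambda>j. Z (s j)) \<longlonglongrightarrow> Zl"
    and "(\<lambda>j. W (s j)) \<longlonglongrightarrow> Wl"
  shows "(\<forall>n\<in>{1..N}. (Xl n * Yl n - unfold_mode N I n Zl) * (Yl n)\<^sup>T = 0\<^sub>m (I n) (r n)) \<and>
    (\<forall>n\<in>{1..N}. (Xl n)\<^sup>T * (Xl n * Yl n - unfold_mode N I n Zl) = 0\<^sub>m (r n) (ncols N I n)) \<and>
    Zl - weighted_fold N I \<alpha> Xl Yl - proj \<Omega> Wl = 0 \<and>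
    proj \<Omega> Zl - B = 0"
proof -
  note Omega = assms(3) and B = assms(5) and alpha = assms(7,8) and X_Suc = assms(13)
    and Y_Suc = assms(14) and Z_Suc = assms(15) and W = assms(16) and s = assms(17)
  let ?U = "\<lambda>k n. unfold_mode N I n (Z k)"
  let ?F = "\<lambda>k n. fold_mode N I n (X k n * Y k n)"
  let ?wf = "\<lambda>k. weighted_fold N I \<alpha> (X k) (Y k)"
  have carrier: "X k n \<in> carrier_mat (I n) (r n) \<and> Y k n \<in> carrier_mat (r n) (ncols N I n)"
    if n: "n \<in> {1..N}" for k n
  proof (induction k)
    case 0
    show ?case using assms(9,10)[OF n] by simp
  next
    case (Suc k)
    then have X: "X (Suc k) n \<in> carrier_mat (I n) (r n)"
      unfolding X_Suc[OF n] using mult_carrier_mat[OF unfold_mode_carrier, of "(Y k n)\<^sup>T"] by auto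
    from pinv_normal_equation(1)[OF X unfold_mode_carrier Y_Suc[OF n]] X show ?case by simp
  qed
  have XY: "X k n * Y k n \<in> carrier_mat (I n) (ncols N I n)" if "n \<in> {1..N}" for k n
    using carrier[OF that, of k] by (auto intro: mult_carrier_mat)
  have normal: "(X (Suc k) n)\<^sup>T * (X (Suc k) n * Y (Suc k) n - ?U k n) = 0\<^sub>m (r n) (ncols N I n)"
    if n: "n \<in> {1..N}" for k n
    using carrier[OF n, of "Suc k"] by (intro pinv_normal_equation(2)[OF _ unfold_mode_carrier Y_Suc[OF n]]) auto
  \<comment> \<open>The condition on \<open>n\<close> stands below the quantifier so that choice
    yields one total function \<open>D\<close>.\<close>
  have "\<forall>k n. \<exists>D. n \<in> {1..N} \<longrightarrow> D \<in> carrier_mat (I n) (ncols N I n) \<and>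
      D * (Y k n)\<^sup>T = (X k n * Y k n - ?U k n) * (Y k n)\<^sup>T \<and>
      frob_sq (X (Suc k) n * Y (Suc k) n - ?U k n) + frob_sq D \<le> frob_sq (X k n * Y k n - ?U k n)"
  proof (intro allI)
    fix k n
    show "\<exists>D. n \<in> {1..N} \<longrightarrow> D \<in> carrier_mat (I n) (ncols N I n) \<and>
      D * (Y k n)\<^sup>T = (X k n * Y k n - ?U k n) * (Y k n)\<^sup>T \<and>
      frob_sq (X (Suc k) n * Y (Suc k) n - ?U k n) + frob_sq D \<le> frob_sq (X k n * Y k n - ?U k n)"
    proof (cases "n \<in> {1..N}")
      case n: True
      from als_descent[OF _ _ unfold_mode_carrier _ X_Suc[OF n] normal[OF n]] carrier[OF n]
      show ?thesis by blast
    qed blast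
  qed
  then obtain D where D: "\<And>k n. n \<in> {1..N} \<Longrightarrow> D k n \<in> carrier_mat (I n) (ncols N I n)"
    "\<And>k n. n \<in> {1..N} \<Longrightarrow> D k n * (Y k n)\<^sup>T = (X k n * Y k n - ?U k n) * (Y k n)\<^sup>T"
    "\<And>k n. n \<in> {1..N} \<Longrightarrow> frob_sq (X (Suc k) n * Y (Suc k) n - ?U k n) + frob_sq (D k n)
      \<le> frob_sq (X k n * Y k n - ?U k n)"
    by metis

  \<comment> \<open>The constraint and the decrease of the objective\<close>
  have Z_Omega: "Z k i = B i" if "i \<in> \<Omega>" for k i
  proof (cases k)
    case 0
    with fun_cong[OF assms(12), of i] that show ?thesis by (simp add: proj_def)
  qed (use that Z_Suc in \<open>simp add: proj_def\<close>)
  \<comment> \<open>Only for successors, since \<open>Z 0\<close> is arbitrary on the rest of the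
    index set. Off the index set both sides vanish.\<close>
  have Z_off: "Z (Suc k) i = ?wf (Suc k) i" if "i \<notin> \<Omega>" for k i
    using that weighted_fold_off_idx[OF XY] by (auto simp: Z_Suc B proj_def)

  \<comment> \<open>Twice the objective, with separate counters for the factors and for
    \<open>Z\<close>: \<open>f (Suc k) k\<close> is the value between the two half steps.\<close>
  define f where "f k l = (\<Sum>n = 1..N. \<alpha> n * frob_sq (X k n * Y k n - ?U l n))" for k l
  have f_nonneg: "f k l \<ge> 0" for k l
    unfolding f_def using alpha(1) by (intro sum_nonneg mult_nonneg_nonneg frob_sq_nonneg) (auto simp: less_imp_le)
  have f_fold: "f k l = (\<Sum>i\<in>idx N I. \<Sum>n = 1..N. \<alpha> n * (?F k n i - Z l i)\<^sup>2)" for k l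
  proof -
    have "f k l = (\<Sum>n = 1..N. \<Sum>i\<in>idx N I. \<alpha> n * (?F k n i - Z l i)\<^sup>2)"
      unfolding f_def by (intro sum.cong refl) (simp add: frob_sq_minus_unfold XY sum_distrib_left)
    also have "\<dots> = (\<Sum>i\<in>idx N I. \<Sum>n = 1..N. \<alpha> n * (?F k n i - Z l i)\<^sup>2)"
      by (rule sum.swap)
    finally show ?thesis .
  qed
  have Z_step: "f (Suc k) (Suc k) + (\<Sum>i\<in>idx N I. (Z (Suc k) i - Z k i)\<^sup>2) = f (Suc k) k" for k
  proof -
    have "f (Suc k) k - f (Suc k) (Suc k) =
      (\<Sum>i\<in>idx N I. (?wf (Suc k) i - Z k i)\<^sup>2 - (?wf (Suc k) i - Z (Suc k) i)\<^sup>2)"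
      unfolding f_fold weighted_fold_def weighted_sq_diff[OF alpha(2), symmetric]
      by (simp only: sum_subtractf)
    also have "\<dots> = (\<Sum>i\<in>idx N I. (Z (Suc k) i - Z k i)\<^sup>2)"
    proof (intro sum.cong refl)
      fix i
      \<comment> \<open>On \<open>\<Omega>\<close> both tensors equal \<open>B\<close> and
        everything cancels; elsewhere the new entry is the weighted mean, so the second square
        vanishes.\<close>
      show "(?wf (Suc k) i - Z k i)\<^sup>2 - (?wf (Suc k) i - Z (Suc k) i)\<^sup>2 = (Z (Suc k) i - Z k i)\<^sup>2"
        by (cases "i \<in> \<Omega>") (simp_all add: Z_Omega Z_off)
    qed
    finally show ?thesis by simp
  qed
  have XY_step: "f (Suc k) k + (\<Sum>n = 1..N. \<alpha> n * frob_sq (D k n)) \<le> f k k" for k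
    unfolding f_def sum.distrib[symmetric] distrib_left[symmetric]
    using D(3) alpha(1) by (intro sum_mono mult_left_mono) (auto simp: less_imp_le)
  have sum_D_nonneg: "(\<Sum>n = 1..N. \<alpha> n * frob_sq (D k n)) \<ge> 0" for k
    using alpha(1) by (intro sum_nonneg mult_nonneg_nonneg frob_sq_nonneg) (auto simp: less_imp_le)
  have sum_Z_nonneg: "(\<Sum>i\<in>idx N I. (Z (Suc k) i - Z k i)\<^sup>2) \<ge> 0" for k
    by (intro sum_nonneg) auto

  \<comment> \<open>Vanishing of the steps\<close>
  have sum_D: "(\<lambda>k. \<Sum>n = 1..N. \<alpha> n * frob_sq (D k n)) \<longlonglongrightarrow> 0"
  proof (rule descent_tendsto_zero[where f = "\<lambda>k. f k k"])
    show "f (Suc k) (Suc k) + (\<Sum>n = 1..N. \<alpha> n * frob_sq (D k n)) \<le> f k k" for k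
      using Z_step[of k] XY_step[of k] sum_Z_nonneg[of k] by linarith
  qed (use f_nonneg sum_D_nonneg in auto)
  have sum_Z: "(\<lambda>k. \<Sum>i\<in>idx N I. (Z (Suc k) i - Z k i)\<^sup>2) \<longlonglongrightarrow> 0"
  proof (rule descent_tendsto_zero[where f = "\<lambda>k. f k k"])
    show "f (Suc k) (Suc k) + (\<Sum>i\<in>idx N I. (Z (Suc k) i - Z k i)\<^sup>2) \<le> f k k" for k
      using Z_step[of k] XY_step[of k] sum_D_nonneg[of k] by linarith
  qed (use f_nonneg sum_Z_nonneg in auto)

  have D_lim: "mat_lim (\<lambda>k. D k n) (0\<^sub>m (I n) (ncols N I n))" if n: "n \<in> {1..N}" for n
  proof (rule mat_lim_frob_sq_zero[OF D(1)[OF n]])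
    have "\<alpha> n * frob_sq (D k n) \<le> (\<Sum>n = 1..N. \<alpha> n * frob_sq (D k n))" for k
      using n alpha(1) by (intro member_le_sum[of n "{1..N}" "\<lambda>n. \<alpha> n * frob_sq (D k n)"])
        (auto simp: less_imp_le frob_sq_nonneg)
    then have "(\<lambda>k. \<alpha> n * frob_sq (D k n)) \<longlonglongrightarrow> 0"
      using alpha(1)[OF n]
      by (intro tendsto_sandwich[OF _ _ tendsto_const sum_D] always_eventually)
        (auto simp: less_imp_le frob_sq_nonneg)
    from tendsto_mult[OF tendsto_const[of "inverse (\<alpha> n)"] this]
    show "(\<lambda>k. frob_sq (D k n)) \<longlonglongrightarrow> 0"
      using alpha(1)[OF n] by simp
  qed
  have Z_diff: "(\<lambda>k. Z (Suc k) i - Z k i) \<longlonglongrightarrow> 0" for i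
  proof (cases "i \<in> idx N I")
    case True
    have "(Z (Suc k) i - Z k i)\<^sup>2 \<le> (\<Sum>i\<in>idx N I. (Z (Suc k) i - Z k i)\<^sup>2)" for k
      using True by (intro member_le_sum[of i "idx N I" "\<lambda>i. (Z (Suc k) i - Z k i)\<^sup>2"]) auto
    then have "(\<lambda>k. (Z (Suc k) i - Z k i)\<^sup>2) \<longlonglongrightarrow> 0"
      by (intro tendsto_sandwich[OF _ _ tendsto_const sum_Z] always_eventually) auto
    from tendsto_real_sqrt[OF this] show ?thesis by (simp add: tendsto_rabs_zero_iff)
  next
    \<comment> \<open>The sum of squares controls only the index set; elsewhere every iterate is
      zero.\<close>
    case False
    have "Z k i = 0" for k
    proof (cases k)
      case 0
      then show ?thesis using assms(11) False by (simp add: tensors_def)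
    next
      case (Suc l)
      have "i \<notin> \<Omega>" using False Omega by auto
      then show ?thesis unfolding Suc using Z_off weighted_fold_off_idx[OF XY False] by simp
    qed
    then show ?thesis by simp
  qed

  \<comment> \<open>Passage to the limit\<close>
  have Zl: "(\<lambda>j. Z (s j) i) \<longlonglongrightarrow> Zl i" and Wl: "(\<lambda>j. W (s j) i) \<longlonglongrightarrow> Wl i" for i
    \<comment> \<open>Evaluation at \<open>i\<close> is continuous in the product topology.\<close>
    using assms(20,21) continuous_on_tendsto_compose[OF continuous_on_product_coordinates[of i]] by auto
  have car_l: "Xl n \<in> carrier_mat (I n) (r n)" "Yl n \<in> carrier_mat (r n) (ncols N I n)"
    if n: "n \<in> {1..N}" for n
    using mat_lim_carrier[OF assms(18)[OF n], of 0] mat_lim_carrier[OF assms(19)[OF n], of 0]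
      carrier[OF n, of "s 0"] by auto
  note dim_l = car_l[THEN carrier_matD(1)] car_l[THEN carrier_matD(2)]
  have dim_U: "dim_row (unfold_mode N I n A) = I n" "dim_col (unfold_mode N I n A) = ncols N I n" for n A
    unfolding unfold_mode_def by auto
  have XYl: "mat_lim (\<lambda>j. X (s j) n * Y (s j) n) (Xl n * Yl n)" if n: "n \<in> {1..N}" for n
    using assms(18,19)[OF n] dim_l[OF n] by (intro mat_lim_mult) auto
  have s_top: "filterlim s at_top sequentially"
    using s by (rule filterlim_subseq)
  \<comment> \<open>Predecessors of the subsequence indices. The shift to \<open>Suc j\<close>
    guards against \<open>s 0 = 0\<close>: strict monotonicity gives
    \<open>s (Suc j) \<ge> Suc j\<close>.\<close>
  define u where "u j = s (Suc j) - 1" for j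
  have u: "s (Suc j) = Suc (u j)" for j
    using seq_suble[OF s, of "Suc j"] by (simp add: u_def)
  have u_top: "filterlim u at_top sequentially"
  proof (rule filterlim_at_top_mono[OF filterlim_ident always_eventually], rule allI)
    show "j \<le> u j" for j using seq_suble[OF s, of "Suc j"] unfolding u_def by simp
  qed
  \<comment> \<open>\<open>Z (u j)\<close> differs from \<open>Z (s (Suc j))\<close> by one step of
    the iteration, which tends to zero.\<close>
  have Zu: "(\<lambda>j. Z (u j) i) \<longlonglongrightarrow> Zl i" for i
    using tendsto_diff[OF LIMSEQ_Suc[OF Zl[of i]] filterlim_compose[OF Z_diff[of i] u_top]]
    by (simp add: u)

  \<comment> \<open>The residual times \<open>(Y k n)\<^sup>T\<close> equals
    \<open>D k n * (Y k n)\<^sup>T\<close>; along the subsequence \<open>D\<close> vanishes while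
    \<open>Y\<close> converges.\<close>
  have KKT_X: "(Xl n * Yl n - unfold_mode N I n Zl) * (Yl n)\<^sup>T = 0\<^sub>m (I n) (r n)" if n: "n \<in> {1..N}" for n
  proof -
    have "mat_lim (\<lambda>j. (X (s j) n * Y (s j) n - ?U (s j) n) * (Y (s j) n)\<^sup>T)
        ((Xl n * Yl n - unfold_mode N I n Zl) * (Yl n)\<^sup>T)"
      by (intro mat_lim_mult mat_lim_minus XYl n mat_lim_unfold_mode Zl mat_lim_transpose assms(19))
        (use dim_l[OF n] dim_U in auto)
    moreover have "mat_lim (\<lambda>j. D (s j) n * (Y (s j) n)\<^sup>T) (0\<^sub>m (I n) (ncols N I n) * (Yl n)\<^sup>T)"
      by (intro mat_lim_mult mat_lim_compose[OF D_lim[OF n] s_top] mat_lim_transpose assms(19) n)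
        (use dim_l[OF n] in auto)
    ultimately have "(Xl n * Yl n - unfold_mode N I n Zl) * (Yl n)\<^sup>T = 0\<^sub>m (I n) (ncols N I n) * (Yl n)\<^sup>T"
      unfolding D(2)[OF n] by (rule mat_lim_unique)
    also have "\<dots> = 0\<^sub>m (I n) (r n)"
      using car_l[OF n] by (intro left_mult_zero_mat) auto
    finally show ?thesis .
  qed
  have KKT_Y: "(Xl n)\<^sup>T * (Xl n * Yl n - unfold_mode N I n Zl) = 0\<^sub>m (r n) (ncols N I n)"
    if n: "n \<in> {1..N}" for n
  proof -
    note shift = mat_lim_compose[OF _ filterlim_Suc]
    \<comment> \<open>With \<open>Z\<close> taken at the predecessor \<open>u j\<close>, every term
      of this sequence is exactly zero by \<open>normal\<close>.\<close>
    have "mat_lim (\<lambda>j. (X (s (Suc j)) n)\<^sup>T * (X (s (Suc j)) n * Y (s (Suc j)) n - ?U (u j) n))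
        ((Xl n)\<^sup>T * (Xl n * Yl n - unfold_mode N I n Zl))"
      by (intro mat_lim_mult mat_lim_minus shift[OF XYl] n mat_lim_unfold_mode Zu mat_lim_transpose
          shift[OF assms(18)]) (use dim_l[OF n] dim_U in auto)
    then have "mat_lim (\<lambda>j. 0\<^sub>m (r n) (ncols N I n)) ((Xl n)\<^sup>T * (Xl n * Yl n - unfold_mode N I n Zl))"
      unfolding u normal[OF n] .
    moreover have "mat_lim (\<lambda>j. 0\<^sub>m (r n) (ncols N I n)) (0\<^sub>m (r n) (ncols N I n))"
      unfolding mat_lim_def by simp
    ultimately show ?thesis by (rule mat_lim_unique)
  qed
  have "Zl i - weighted_fold N I \<alpha> Xl Yl i - proj \<Omega> Wl i = 0" for i
  proof -
    have wf: "(\<lambda>j. ?wf (s j) i) \<longlonglongrightarrow> weighted_fold N I \<alpha> Xl Yl i"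
      using assms(18,19) car_l by (intro weighted_fold_tendsto) auto
    have "(\<lambda>j. proj \<Omega> (W (s j)) i) \<longlonglongrightarrow> proj \<Omega> Wl i"
      unfolding proj_def using Wl by simp
    \<comment> \<open>The shift skips a possible iterate \<open>0\<close>, at which the identity can
      fail.\<close>
    from tendsto_diff[OF tendsto_diff[OF Zl wf] this]
    have "(\<lambda>j. Z (s (Suc j)) i - ?wf (s (Suc j)) i - proj \<Omega> (W (s (Suc j))) i) \<longlonglongrightarrow>
        Zl i - weighted_fold N I \<alpha> Xl Yl i - proj \<Omega> Wl i"
      by (rule LIMSEQ_Suc)
    moreover have "Z (Suc k) i - ?wf (Suc k) i - proj \<Omega> (W (Suc k)) i = 0" for k
      by (cases "i \<in> \<Omega>") (simp_all add: Z_Omega Z_off W proj_def)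
    ultimately show ?thesis
      unfolding u by (simp add: LIMSEQ_const_iff)
  qed
  moreover have "proj \<Omega> Zl i - B i = 0" for i
  proof (cases "i \<in> \<Omega>")
    case True
    then have "Zl i = B i"
      using Zl[of i] by (simp add: Z_Omega LIMSEQ_const_iff)
    with True show ?thesis by (simp add: proj_def)
  qed (simp add: proj_def B)
  ultimately show ?thesis
    using KKT_X KKT_Y by (auto simp: fun_eq_iff)
qed

end
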